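(* Let $p,q\ge1$, $d_h,\rho_h>0$ ($1\le h\le q$), $\xi_1,\dots,\xi_p\in\mathbb R$ pairwise distinct with $\xi_i+\rho_h>0$ for all $i,h$. Let $\boldsymbol m\in\mathbb N_0^q$ be near the diagonal ($|m_i-m_j|\le1$), let the rates $\rho_j$ with $m_j>0$ be pairwise distinct, and let $\boldsymbol n\in\mathbb N_0^p$ with $|\boldsymbol n|=|\boldsymbol m|+1$. For $n_i\ge1$ let $A^{(i),\mathrm{LII}}_{\boldsymbol n,\boldsymbol m}$ be the polynomial $$A^{(i),\mathrm{LII}}_{\boldsymbol n,\boldsymbol m}(y)=\frac{(-1)^{|\boldsymbol n|}}{(n_i-1)!}\left.\frac{\mathrm d^{n_i-1}}{\mathrm dz^{n_i-1}}\left[\frac{\prod_h(z+\rho_h)^{d_h+m_h}}{\prod_{k\ne i}(z-\xi_k)^{n_k}}\mathrm e^{-(z-\xi_i)y}\right]\right|_{z=\xi_i}.$$ Put $M_i=n_i-1$, $\lambda_h=d_h+m_h$, $c_{i,h}=\xi_i+\rho_h$, $\Delta_{i,k}=\xi_i-\xi_k$, $\mathcal H_i=\prod_{h=1}^qc_{i,h}^{\lambda_h}\big/\prod_{k\ne i}\Delta_{i,k}^{n_k}$. Choose $h_0\in\{1,\dots,q\}$, set $\chi_{i,h_0}=\lambda_{h_0}-M_i+1$, and define $$\mathfrak F_{i,h_0}(y)=\sum_{\ell,\boldsymbol r,\boldsymbol s\ge0}\frac{(-M_i)_T}{(\chi_{i,h_0})_T}\frac{(c_{i,h_0}y)^\ell}{\ell!}\prod_{\substack{1\le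 h\le q\\ h\ne h_0}}\frac{(-\lambda_h)_{r_h}}{r_h!}\Bigl(\frac{c_{i,h_0}}{c_{i,h}}\Bigr)^{r_h}\prod_{\substack{1\le k\le p\\ k\ne i}}\frac{(n_k)_{s_k}}{s_k!}\Bigl(\frac{c_{i,h_0}}{\Delta_{i,k}}\Bigr)^{s_k},$$ where $T=\ell+\sum_{h\ne h_0}r_h+\sum_{k\ne i}s_k$. Then for every $i$ with $n_i\ge1$ $$A^{(i),\mathrm{LII}}_{\boldsymbol n,\boldsymbol m}(y)=(-1)^{|\boldsymbol n|}\mathcal H_i\,\frac{(\chi_{i,h_0})_{M_i}}{M_i!\,c_{i,h_0}^{M_i}}\,\mathfrak F_{i,h_0}(y).$$ The value of the right-hand side is independent of $h_0$; if a displayed denominator parameter is exceptional, the formula is understood by polynomial continuation.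
   Context: $(a)_k=a(a+1)\cdots(a+k-1)$, $(a)_0=1$. The sums run over $\ell\in\mathbb N_0$, $\boldsymbol r=(r_h)_{h\ne h_0}$, $\boldsymbol s=(s_k)_{k\ne i}$ with entries in $\mathbb N_0$; the factor $(-M_i)_T$ restricts to $T\le M_i$, so $\mathfrak F_{i,h_0}$ is a terminating multiple Kampé de Fériet polynomial. Polynomial continuation means coefficientwise continuation in the parameters of the complete finite expression, including its prefactor, after cancellation of removable singularities. (The polynomials $A^{(i),\mathrm{LII}}_{\boldsymbol n,\boldsymbol m}$ are the components of the mixed-type form $\sum_iA^{(i),\mathrm{LII}}_{\boldsymbol n,\boldsymbol m}(y)\mathrm e^{-\xi_iy}$ of Laguerre type of the second kind.) *)

theory Defs
  imports "HOL-Analysis.Analysis" "HOL-Computational_Algebra.Polynomial"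
begin

text \<open>
  The index ranges \<open>1..p\<close> and \<open>1..q\<close> are the finite types \<open>'p\<close> and \<open>'q\<close>.  The real parameters
  \<open>(d, \<rho>, \<xi>)\<close> are vectors, so that limits in all of them jointly make sense; the multi-indices
  \<open>m\<close> and \<open>n\<close> are kept fixed when the parameters are varied.
\<close>

type_synonym ('p, 'q) LII_param = "(real ^ 'q) \<times> (real ^ 'q) \<times> (real ^ 'p)"

definition LII_admissible :: "('q::finite \<Rightarrow> nat) \<Rightarrow> ('p::finite, 'q) LII_param set" where
  "LII_admissible m = {(d, \<rho>, \<xi>).
     (\<forall>h. d $ h > 0) \<and> (\<forall>h. \<rho> $ h > 0) \<and>
     (\<forall>i k. i \<noteq> k \<longrightarrow> \<xi> $ i \<noteq> \<xi> $ k) \<and>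
     (\<forall>i h. \<xi> $ i + \<rho> $ h > 0) \<and>
     (\<forall>h h'. h \<noteq> h' \<longrightarrow> m h > 0 \<longrightarrow> m h' > 0 \<longrightarrow> \<rho> $ h \<noteq> \<rho> $ h')}"

definition near_diagonal :: "('q::finite \<Rightarrow> nat) \<Rightarrow> bool" where
  "near_diagonal m \<longleftrightarrow> (\<forall>h h'. \<bar>int (m h) - int (m h')\<bar> \<le> 1)"

definition LII_A :: "('q::finite \<Rightarrow> nat) \<Rightarrow> ('p::finite \<Rightarrow> nat) \<Rightarrow> 'p \<Rightarrow> ('p, 'q) LII_param \<Rightarrow> real \<Rightarrow> real" where
  "LII_A m n i = (\<lambda>(d, \<rho>, \<xi>) y.
     (-1) ^ (\<Sum>k\<in>UNIV. n k) / fact (n i - 1) *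
     (deriv ^^ (n i - 1))
       (\<lambda>z. (\<Prod>h\<in>UNIV. (z + \<rho> $ h) powr (d $ h + real (m h))) /
             (\<Prod>k\<in>UNIV - {i}. (z - \<xi> $ k) ^ n k) * exp (- (z - \<xi> $ i) * y))
       (\<xi> $ i))"

definition LII_H :: "('q::finite \<Rightarrow> nat) \<Rightarrow> ('p::finite \<Rightarrow> nat) \<Rightarrow> 'p \<Rightarrow> ('p, 'q) LII_param \<Rightarrow> real" where
  "LII_H m n i = (\<lambda>(d, \<rho>, \<xi>).
     (\<Prod>h\<in>UNIV. (\<xi> $ i + \<rho> $ h) powr (d $ h + real (m h))) /
     (\<Prod>k\<in>UNIV - {i}. (\<xi> $ i - \<xi> $ k) ^ n k))"

definition LII_chi :: "('q::finite \<Rightarrow> nat) \<Rightarrow> ('p::finite \<Rightarrow> nat) \<Rightarrow> 'p \<Rightarrow> 'q \<Rightarrow> ('p, 'q) LII_param \<Rightarrow> real" where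
  "LII_chi m n i h0 = (\<lambda>(d, \<rho>, \<xi>). d $ h0 + real (m h0) - real (n i - 1) + 1)"

text \<open>
  The tuples \<open>r = (r\<^sub>h)\<^bsub>h \<noteq> h0\<^esub>\<close> and \<open>s = (s\<^sub>k)\<^bsub>k \<noteq> i\<^esub>\<close> are extensional functions on the complements
  of \<open>h0\<close> and \<open>i\<close>.  All terms with \<open>T > n i - 1\<close> vanish, because of the factor
  \<open>pochhammer (- real (n i - 1)) T\<close> (also where \<open>pochhammer \<chi> T = 0\<close>, as \<open>0 / 0 = 0\<close>), so that the
  infinite sum has finite support.
\<close>

definition LII_F :: "('q::finite \<Rightarrow> nat) \<Rightarrow> ('p::finite \<Rightarrow> nat) \<Rightarrow> 'p \<Rightarrow> 'q \<Rightarrow> ('p, 'q) LII_param \<Rightarrow> real \<Rightarrow> real" where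
  "LII_F m n i h0 = (\<lambda>(d, \<rho>, \<xi>) y.
     \<Sum>\<^sub>\<infinity>(l, r, s) \<in> UNIV \<times> (UNIV - {h0} \<rightarrow>\<^sub>E UNIV) \<times> (UNIV - {i} \<rightarrow>\<^sub>E UNIV).
       (let T = l + (\<Sum>h\<in>UNIV - {h0}. r h) + (\<Sum>k\<in>UNIV - {i}. s k);
            c = (\<lambda>h. \<xi> $ i + \<rho> $ h)
        in pochhammer (- real (n i - 1)) T / pochhammer (LII_chi m n i h0 (d, \<rho>, \<xi>)) T *
           ((c h0 * y) ^ l / fact l) *
           (\<Prod>h\<in>UNIV - {h0}. pochhammer (- (d $ h + real (m h))) (r h) / fact (r h) * (c h0 / c h) ^ r h) *
           (\<Prod>k\<in>UNIV - {i}. pochhammer (real (n k)) (s k) / fact (s k) * (c h0 / (\<xi> $ i - \<xi> $ k)) ^ s k)))"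

definition LII_rhs :: "('q::finite \<Rightarrow> nat) \<Rightarrow> ('p::finite \<Rightarrow> nat) \<Rightarrow> 'p \<Rightarrow> 'q \<Rightarrow> ('p, 'q) LII_param \<Rightarrow> real \<Rightarrow> real" where
  "LII_rhs m n i h0 = (\<lambda>(d, \<rho>, \<xi>) y.
     (-1) ^ (\<Sum>k\<in>UNIV. n k) * LII_H m n i (d, \<rho>, \<xi>) *
     (pochhammer (LII_chi m n i h0 (d, \<rho>, \<xi>)) (n i - 1) /
       (fact (n i - 1) * (\<xi> $ i + \<rho> $ h0) ^ (n i - 1))) *
     LII_F m n i h0 (d, \<rho>, \<xi>) y)"

text \<open>
  The denominator parameter is exceptional if one of the denominators \<open>pochhammer \<chi> T\<close> with
  \<open>T \<le> n i - 1\<close> vanishes.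
\<close>

definition LII_exceptional :: "('q::finite \<Rightarrow> nat) \<Rightarrow> ('p::finite \<Rightarrow> nat) \<Rightarrow> 'p \<Rightarrow> 'q \<Rightarrow> ('p, 'q) LII_param \<Rightarrow> bool" where
  "LII_exceptional m n i h0 x \<longleftrightarrow> (\<exists>T \<le> n i - 1. pochhammer (LII_chi m n i h0 x) T = 0)"

text \<open>
  \<open>P\<close> is the coefficientwise continuation to \<open>x\<close> of a family \<open>f\<close> of real polynomial functions
  with parameters in \<open>S\<close>.  The condition \<open>x islimpt S\<close> makes \<open>P\<close> unique.
\<close>

definition poly_continuation ::
  "('a::topological_space \<Rightarrow> real \<Rightarrow> real) \<Rightarrow> 'a set \<Rightarrow> 'a \<Rightarrow> real poly \<Rightarrow> bool" where
  "poly_continuation f S x P \<longleftrightarrow> x islimpt S \<and>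
     (\<exists>Q. (\<forall>t\<in>S. \<forall>y. f t y = poly (Q t) y) \<and>
          (\<forall>j. ((\<lambda>t. coeff (Q t) j) \<longlongrightarrow> coeff P j) (at x within S)))"

definition LII_continuation ::
  "('q::finite \<Rightarrow> nat) \<Rightarrow> ('p::finite \<Rightarrow> nat) \<Rightarrow> 'p \<Rightarrow> 'q \<Rightarrow> ('p, 'q) LII_param \<Rightarrow> real poly \<Rightarrow> bool" where
  "LII_continuation m n i h0 =
     poly_continuation (LII_rhs m n i h0) {t \<in> LII_admissible m. \<not> LII_exceptional m n i h0 t}"

definition LII_value ::
  "('q::finite \<Rightarrow> nat) \<Rightarrow> ('p::finite \<Rightarrow> nat) \<Rightarrow> 'p \<Rightarrow> 'q \<Rightarrow> ('p, 'q) LII_param \<Rightarrow> real \<Rightarrow> real" where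
  "LII_value m n i h0 x =
     (if LII_exceptional m n i h0 x then poly (THE P. LII_continuation m n i h0 x P)
      else LII_rhs m n i h0 x)"

end

theory Submission
  imports Defs
begin

text \<open>
  With \<open>z = \<xi>\<^sub>i + t\<close> the function to be differentiated becomes \<open>H\<^sub>i\<close> times the product of the binomial
  series \<open>(1 + t / c\<^sub>h) powr \<lambda>\<^sub>h\<close>, \<open>(1 + t / \<Delta>\<^sub>k) powr (- n\<^sub>k)\<close> and of \<open>exp (- t y)\<close>, and \<open>A\<close> is its
  coefficient of \<open>t ^ M\<close>.  Expanding all factors but the one of \<open>h0\<close> produces the summation indices
  \<open>(l, r, s)\<close> of total degree \<open>T\<close>; the factor of \<open>h0\<close> contributes \<open>\<lambda> gchoose (M - T)\<close>, which is
  the quotient of Pochhammer symbols in \<open>T\<close>.  At an exceptional parameter, the coefficients of \<open>A\<close>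
  as a polynomial in \<open>y\<close> are continuous in the parameters, and adding a small number to \<open>d\<close> at \<open>h0\<close>
  leads to non-exceptional parameters, so that \<open>A\<close> is the unique continuation.
\<close>

section \<open>Sums graded by total degree and products of formal power series\<close>

text \<open>\<open>F\<close> is the generating function of the weights \<open>a\<close> graded by
  \<open>deg\<close>. Finiteness of the fibres is part of the notion because \<open>sum\<close> over
  an infinite set is 0 by convention, which would break the product rule.\<close>

definition graded_sum :: "'x set \<Rightarrow> ('x \<Rightarrow> nat) \<Rightarrow> ('x \<Rightarrow> 'a::comm_ring_1) \<Rightarrow> 'a fps \<Rightarrow> bool" where
  "graded_sum X deg a F \<longleftrightarrow>
     (\<forall>N. finite {x \<in> X. deg x = N}) \<and> (\<forall>N. fps_nth F N = (\<Sum>x | x \<in> X \<and> deg x = N. a x))"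

lemma graded_sum_id: "graded_sum UNIV (\<lambda>N. N) (fps_nth F) F"
  by (simp add: graded_sum_def)

text \<open>Cauchy product: the fibre of degree \<open>N\<close> in \<open>X \<times> Y\<close> is
  the disjoint union of the products of fibres of degrees \<open>j\<close> and
  \<open>N - j\<close>.\<close>

lemma graded_sum_mult:
  assumes "graded_sum X dX a F" and "graded_sum Y dY b G"
  shows "graded_sum (X \<times> Y) (\<lambda>(x, y). dX x + dY y) (\<lambda>(x, y). a x * b y) (F * G)"
proof -
  let ?X = "\<lambda>N. {x \<in> X. dX x = N}" and ?Y = "\<lambda>N. {y \<in> Y. dY y = N}"
  have fin: "finite (?X N)" "finite (?Y N)" for N
    using assms by (auto simp: graded_sum_def)
  have split: "{z \<in> X \<times> Y. (case z of (x, y) \<Rightarrow> dX x + dY y) = N} =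
      (\<Union>j\<in>{0..N}. ?X j \<times> ?Y (N - j))" for N
    by auto
  have "fps_nth (F * G) N =
      (\<Sum>z | z \<in> X \<times> Y \<and> (case z of (x, y) \<Rightarrow> dX x + dY y) = N. case z of (x, y) \<Rightarrow> a x * b y)" for N
  proof -
    have "fps_nth (F * G) N = (\<Sum>j=0..N. (\<Sum>x\<in>?X j. a x) * (\<Sum>y\<in>?Y (N - j). b y))"
      using assms by (simp add: fps_mult_nth graded_sum_def)
    also have "\<dots> = (\<Sum>j=0..N. \<Sum>(x, y)\<in>?X j \<times> ?Y (N - j). a x * b y)"
      by (simp add: sum_product sum.cartesian_product)
    also have "\<dots> = (\<Sum>(x, y)\<in>(\<Union>j\<in>{0..N}. ?X j \<times> ?Y (N - j)). a x * b y)"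
      by (rule sum.UNION_disjoint[symmetric]) (auto simp: fin)
    finally show ?thesis by (simp only: split)
  qed
  then show ?thesis
    unfolding graded_sum_def split using fin by auto
qed

lemma graded_sum_reindex:
  assumes "graded_sum X (dY \<circ> g) (b \<circ> g) F" and "bij_betw g X Y"
  shows "graded_sum Y dY b F"
proof -
  have eq: "{y \<in> Y. dY y = N} = g ` {x \<in> X. (dY \<circ> g) x = N}" for N
    using assms(2) by (auto simp: bij_betw_def)
  have "inj_on g {x \<in> X. (dY \<circ> g) x = N}" for N
    using assms(2) by (auto simp: bij_betw_def inj_on_def)
  then have "(\<Sum>y | y \<in> Y \<and> dY y = N. b y) = (\<Sum>x | x \<in> X \<and> (dY \<circ> g) x = N. (b \<circ> g) x)" for N
    unfolding eq by (subst sum.reindex) auto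
  moreover have "finite {y \<in> Y. dY y = N}" for N
    unfolding eq using assms(1) by (auto simp: graded_sum_def)
  ultimately show ?thesis
    using assms(1) by (simp add: graded_sum_def)
qed

lemma graded_sum_prod:
  assumes "finite A"
  shows "graded_sum (A \<rightarrow>\<^sub>E UNIV) (\<lambda>r. \<Sum>x\<in>A. r x) (\<lambda>r. \<Prod>x\<in>A. fps_nth (F x) (r x)) (\<Prod>x\<in>A. F x)"
  using assms
proof induction
  case empty
  \<comment> \<open>The only extensional function on the empty set is the constant
    \<open>undefined\<close>. It has degree 0 and weight 1, which gives the series 1.\<close>
  have "{x. x = (\<lambda>x. undefined) \<and> N = 0} = (if N = 0 then {\<lambda>x. undefined} else {})" for N :: nat
    by auto
  then show ?case by (auto simp: graded_sum_def)
next
  case (insert x A)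
  \<comment> \<open>A tuple on \<open>insert x A\<close> is an exponent at \<open>x\<close> together
    with a tuple on \<open>A\<close>; extensionality makes this a bijection.\<close>
  let ?g = "\<lambda>(j, r). r(x := j)"
  have bij: "bij_betw ?g (UNIV \<times> (A \<rightarrow>\<^sub>E UNIV)) (insert x A \<rightarrow>\<^sub>E UNIV)"
    unfolding bij_betw_def using inj_combinator[OF insert(2), of "\<lambda>_. UNIV"]
    by (simp add: PiE_insert_eq)
  have s: "(\<Sum>z\<in>A. if z = x then j else r z) = (\<Sum>z\<in>A. r z)" for j :: nat and r
    using insert(2) by (intro sum.cong) auto
  have p: "(\<Prod>z\<in>A. fps_nth (F z) (if z = x then j else r z)) = (\<Prod>z\<in>A. fps_nth (F z) (r z))" for j r
    using insert(2) by (intro prod.cong) auto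
  show ?case
    by (rule graded_sum_reindex[OF _ bij])
      (use graded_sum_mult[OF graded_sum_id[of "F x"] insert(3)] insert(1,2)
        in \<open>simp add: comp_def case_prod_unfold s p\<close>)
qed

text \<open>A weight that depends only on the degree and vanishes beyond \<open>M\<close> reduces
  the infinite sum to the finitely many finite fibres of degree at most \<open>M\<close>.\<close>

lemma infsum_graded_sum:
  fixes a :: "'x \<Rightarrow> real"
  assumes "graded_sum X deg a F" and "\<And>N. N > M \<Longrightarrow> w N = 0"
  shows "(\<Sum>\<^sub>\<infinity>x\<in>X. w (deg x) * a x) = (\<Sum>N\<le>M. w N * fps_nth F N)"
proof -
  let ?X = "\<lambda>N. {x \<in> X. deg x = N}"
  have fin: "finite (?X N)" for N
    using assms by (auto simp: graded_sum_def)
  have "(\<Sum>\<^sub>\<infinity>x\<in>X. w (deg x) * a x) = (\<Sum>\<^sub>\<infinity>x\<in>(\<Union>N\<in>{..M}. ?X N). w (deg x) * a x)"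
  proof (rule infsum_cong_neutral)
    fix x assume "x \<in> X - (\<Union>N\<in>{..M}. ?X N)"
    then have "deg x > M" by auto
    then show "w (deg x) * a x = 0" using assms(2) by simp
  qed auto
  also have "\<dots> = (\<Sum>x\<in>(\<Union>N\<in>{..M}. ?X N). w (deg x) * a x)"
    using fin by (intro infsum_finite) auto
  also have "\<dots> = (\<Sum>N\<le>M. \<Sum>x\<in>?X N. w (deg x) * a x)"
    by (rule sum.UNION_disjoint) (auto simp: fin)
  also have "\<dots> = (\<Sum>N\<le>M. w N * fps_nth F N)"
    using assms(1) by (intro sum.cong refl) (simp add: graded_sum_def sum_distrib_left)
  finally show ?thesis .
qed

section \<open>Taylor expansions and higher derivatives\<close>

text \<open>The Taylor series of \<open>(1 + t / c) powr a\<close> at \<open>t = 0\<close>.\<close>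

definition binomial_fps :: "real \<Rightarrow> real \<Rightarrow> real fps" where
  "binomial_fps a c = Abs_fps (\<lambda>j. (a gchoose j) / c ^ j)"

lemma has_fps_expansion_powr_shift:
  fixes c :: real
  assumes "c > 0"
  shows "(\<lambda>t. (c + t) powr a) has_fps_expansion fps_const (c powr a) * binomial_fps a c"
proof (rule has_fps_expansionI)
  have "eventually (\<lambda>t. t \<in> ball 0 c) (nhds 0)"
    using assms by (intro eventually_nhds_in_open) auto
  then show "\<forall>\<^sub>F t in nhds 0.
      (\<lambda>j. fps_nth (fps_const (c powr a) * binomial_fps a c) j * t ^ j) sums ((c + t) powr a)"
  proof eventually_elim
    case (elim t)
    then have "\<bar>t\<bar> < c" by simp
    from gen_binomial_real'[OF this, of a] show ?case
      using assms by (simp add: binomial_fps_def powr_diff powr_realpow mult_ac add.commute)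
  qed
qed

text \<open>Here \<open>c\<close> stands for a difference of two \<xi>'s and may be negative, where
  \<open>powr\<close> does not describe powers. After factoring out \<open>c\<close>, the base
  \<open>1 + t / c\<close> is positive near 0 and the binomial series applies.\<close>

lemma has_fps_expansion_inverse_power_shift:
  fixes c :: real
  assumes "c \<noteq> 0"
  shows "(\<lambda>t. inverse ((c + t) ^ N)) has_fps_expansion
    fps_const (inverse (c ^ N)) * binomial_fps (- real N) c"
proof (rule has_fps_expansionI)
  have "eventually (\<lambda>t. t \<in> ball 0 \<bar>c\<bar>) (nhds 0)"
    using assms by (intro eventually_nhds_in_open) auto
  then show "\<forall>\<^sub>F t in nhds 0.
      (\<lambda>j. fps_nth (fps_const (inverse (c ^ N)) * binomial_fps (- real N) c) j * t ^ j) sums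
        inverse ((c + t) ^ N)"
  proof eventually_elim
    case (elim t)
    then have small: "\<bar>t / c\<bar> < 1" using assms by simp
    then have "1 + t / c > 0" by linarith
    then have "inverse (c ^ N) * (1 + t / c) powr (- real N) = inverse ((c * (1 + t / c)) ^ N)"
      by (simp add: powr_minus powr_realpow power_mult_distrib)
    also have "c * (1 + t / c) = c + t"
      using assms by (simp add: distrib_left)
    finally show ?case
      using sums_mult[OF gen_binomial_real[OF small, of "- real N"], of "inverse (c ^ N)"]
      by (simp add: binomial_fps_def power_divide mult_ac)
  qed
qed

lemma higher_deriv_has_fps_expansion:
  fixes f :: "real \<Rightarrow> real"
  assumes "f has_fps_expansion F"
  shows "(deriv ^^ N) f 0 = fact N * fps_nth F N"
proof -
  have "(deriv ^^ N) f has_fps_expansion (fps_deriv ^^ N) F"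
    using assms by (induction N) (auto intro: has_fps_expansion_deriv)
  then have "\<forall>\<^sub>F t in nhds 0. eval_fps ((fps_deriv ^^ N) F) t = (deriv ^^ N) f t"
    by (simp add: has_fps_expansion_def)
  then have "(deriv ^^ N) f 0 = fps_nth ((fps_deriv ^^ N) F) 0"
    by (auto dest: eventually_nhds_x_imp_x simp: eval_fps_at_0)
  then show ?thesis
    by (simp add: fps_0th_higher_deriv)
qed

text \<open>\<open>deriv\<close> chooses among all derivatives at a point, and translation preserves
  the set of these candidates, even where it is empty.\<close>

lemma deriv_funpow_shift:
  fixes f :: "real \<Rightarrow> real"
  shows "(deriv ^^ N) (\<lambda>t. f (a + t)) = (\<lambda>t. (deriv ^^ N) f (a + t))"
proof (induction N)
  case (Suc N)
  have "deriv (\<lambda>t. g (a + t)) t = deriv g (a + t)" for g :: "real \<Rightarrow> real" and t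
    unfolding deriv_def using DERIV_shift[of g _ t a] by (simp add: add.commute)
  with Suc show ?case by simp
qed simp

section \<open>Continuity of the series coefficients in the parameters\<close>

lemma tendsto_gbinomial:
  fixes a :: "'b \<Rightarrow> real"
  assumes "(a \<longlongrightarrow> a0) F"
  shows "((\<lambda>x. a x gchoose j) \<longlongrightarrow> a0 gchoose j) F"
  unfolding gbinomial_prod_rev by (intro tendsto_intros assms) simp

lemma tendsto_fps_nth_mult:
  fixes A B :: "'b \<Rightarrow> real fps"
  assumes "\<And>j. ((\<lambda>x. fps_nth (A x) j) \<longlongrightarrow> fps_nth A0 j) F"
    and "\<And>j. ((\<lambda>x. fps_nth (B x) j) \<longlongrightarrow> fps_nth B0 j) F"
  shows "((\<lambda>x. fps_nth (A x * B x) j) \<longlongrightarrow> fps_nth (A0 * B0) j) F"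
  unfolding fps_mult_nth by (intro tendsto_intros assms)

lemma tendsto_fps_nth_prod:
  fixes A :: "'i \<Rightarrow> 'b \<Rightarrow> real fps"
  assumes "\<And>i j. i \<in> I \<Longrightarrow> ((\<lambda>x. fps_nth (A i x) j) \<longlongrightarrow> fps_nth (A0 i) j) F"
  shows "((\<lambda>x. fps_nth (\<Prod>i\<in>I. A i x) j) \<longlongrightarrow> fps_nth (\<Prod>i\<in>I. A0 i) j) F"
  using assms
proof (induction I arbitrary: j rule: infinite_finite_induct)
  case (insert i I)
  then show ?case by (simp add: tendsto_fps_nth_mult)
qed simp_all

lemma tendsto_binomial_fps:
  assumes "(a \<longlongrightarrow> a0) F" and "(c \<longlongrightarrow> c0) F" and "c0 \<noteq> 0"
  shows "((\<lambda>x. fps_nth (binomial_fps (a x) (c x)) j) \<longlongrightarrow> fps_nth (binomial_fps a0 c0) j) F"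
  unfolding binomial_fps_def fps_nth_Abs_fps using assms by (intro tendsto_intros tendsto_gbinomial) auto

section \<open>The polynomial \<open>LII_A\<close> as a Taylor coefficient\<close>

text \<open>Series in \<open>t = z - \<xi> $ i\<close> of the differentiated function, with the
  constant \<open>LII_H\<close> and the exponential split off, so that it does not depend on
  \<open>y\<close>.\<close>

definition LII_series ::
  "('q::finite \<Rightarrow> nat) \<Rightarrow> ('p::finite \<Rightarrow> nat) \<Rightarrow> 'p \<Rightarrow> ('p, 'q) LII_param \<Rightarrow> real fps" where
  "LII_series m n i = (\<lambda>(d, \<rho>, \<xi>).
     (\<Prod>h\<in>UNIV. binomial_fps (d $ h + real (m h)) (\<xi> $ i + \<rho> $ h)) *
     (\<Prod>k\<in>UNIV - {i}. binomial_fps (- real (n k)) (\<xi> $ i - \<xi> $ k)))"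

lemma LII_A_eq_fps_nth:
  assumes "(d, \<rho>, \<xi>) \<in> LII_admissible m"
  shows "LII_A m n i (d, \<rho>, \<xi>) y = (-1) ^ (\<Sum>k\<in>UNIV. n k) * LII_H m n i (d, \<rho>, \<xi>) *
    fps_nth (LII_series m n i (d, \<rho>, \<xi>) * fps_exp (- y)) (n i - 1)"
proof -
  let ?f = "\<lambda>z. (\<Prod>h\<in>UNIV. (z + \<rho> $ h) powr (d $ h + real (m h))) /
    (\<Prod>k\<in>UNIV - {i}. (z - \<xi> $ k) ^ n k) * exp (- (z - \<xi> $ i) * y)"
  let ?B = "\<lambda>h. binomial_fps (d $ h + real (m h)) (\<xi> $ i + \<rho> $ h)"
  let ?C = "\<lambda>k. binomial_fps (- real (n k)) (\<xi> $ i - \<xi> $ k)"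
  have "(\<lambda>t. (\<Prod>h\<in>UNIV. ((\<xi> $ i + \<rho> $ h) + t) powr (d $ h + real (m h))) *
        (\<Prod>k\<in>UNIV - {i}. inverse (((\<xi> $ i - \<xi> $ k) + t) ^ n k)) * exp (- y * t))
      has_fps_expansion
        (\<Prod>h\<in>UNIV. fps_const ((\<xi> $ i + \<rho> $ h) powr (d $ h + real (m h))) * ?B h) *
        (\<Prod>k\<in>UNIV - {i}. fps_const (inverse ((\<xi> $ i - \<xi> $ k) ^ n k)) * ?C k) * fps_exp (- y)"
    using assms
    by (intro has_fps_expansion_mult has_fps_expansion_prod has_fps_expansion_powr_shift
        has_fps_expansion_inverse_power_shift has_fps_expansion_exp)
      (auto simp: LII_admissible_def)
  \<comment> \<open>The values of the factors at \<open>t = 0\<close> multiply to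
    \<open>LII_H\<close>.\<close>
  also have "(\<Prod>h\<in>UNIV. fps_const ((\<xi> $ i + \<rho> $ h) powr (d $ h + real (m h))) * ?B h) *
        (\<Prod>k\<in>UNIV - {i}. fps_const (inverse ((\<xi> $ i - \<xi> $ k) ^ n k)) * ?C k) * fps_exp (- y) =
      fps_const (LII_H m n i (d, \<rho>, \<xi>)) * (LII_series m n i (d, \<rho>, \<xi>) * fps_exp (- y))"
  proof -
    have const: "(\<Prod>h\<in>I. fps_const (g h)) = fps_const (\<Prod>h\<in>I. g h)" for g :: "'i \<Rightarrow> real" and I
      by (induction I rule: infinite_finite_induct) simp_all
    show ?thesis
      by (simp add: prod.distrib const LII_H_def LII_series_def divide_inverse prod_inversef[unfolded comp_def]
          flip: fps_const_mult)
  qed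
  also have "(\<lambda>t. (\<Prod>h\<in>UNIV. ((\<xi> $ i + \<rho> $ h) + t) powr (d $ h + real (m h))) *
        (\<Prod>k\<in>UNIV - {i}. inverse (((\<xi> $ i - \<xi> $ k) + t) ^ n k)) * exp (- y * t)) =
      (\<lambda>t. ?f (\<xi> $ i + t))"
    by (simp add: divide_inverse prod_inversef[unfolded comp_def] algebra_simps)
  finally have "(\<lambda>t. ?f (\<xi> $ i + t)) has_fps_expansion
    fps_const (LII_H m n i (d, \<rho>, \<xi>)) * (LII_series m n i (d, \<rho>, \<xi>) * fps_exp (- y))" .
  from higher_deriv_has_fps_expansion[OF this, of "n i - 1"]
  have "(deriv ^^ (n i - 1)) ?f (\<xi> $ i) = fact (n i - 1) *
      (LII_H m n i (d, \<rho>, \<xi>) * fps_nth (LII_series m n i (d, \<rho>, \<xi>) * fps_exp (- y)) (n i - 1))"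
    using deriv_funpow_shift[of "n i - 1" ?f "\<xi> $ i"]
    by (simp only: add_0_right fps_mult_left_const_nth)
  then show ?thesis
    by (simp add: LII_A_def)
qed

section \<open>The hypergeometric formula at non-exceptional parameters\<close>

text \<open>With \<chi> = a - M + 1, the symbol (\<chi>)_M splits into (\<chi>)_T, which cancels,
  and a remainder equal to (M - T)! times a binomial coefficient. The signs of (-M)_T and (-c)^T
  cancel.\<close>

lemma pochhammer_ratio_eq_gbinomial:
  fixes a c :: real
  assumes "T \<le> M" and "pochhammer (a - real M + 1) T \<noteq> 0" and "c \<noteq> 0"
  shows "pochhammer (a - real M + 1) M / (fact M * c ^ M) *
    (pochhammer (- real M) T / pochhammer (a - real M + 1) T * (- c) ^ T) =
    (a gchoose (M - T)) / c ^ (M - T)"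
proof -
  have "pochhammer (a - real M + 1) M =
      pochhammer (a - real M + 1) T * pochhammer (a - real (M - T) + 1) (M - T)"
    using pochhammer_product[OF assms(1), of "a - real M + 1"] assms(1)
    by (simp add: of_nat_diff algebra_simps)
  moreover have "pochhammer (- real M) T = (-1) ^ T * (fact M / fact (M - T))"
  proof -
    \<comment> \<open>Splitting (-M)_M = (-1)^M M! at \<open>T\<close> yields (-M)_T as a
      quotient.\<close>
    have "pochhammer (- real M) M = pochhammer (- real M) T * pochhammer (- real (M - T)) (M - T)"
      using pochhammer_product[OF assms(1), of "- real M"] assms(1) by (simp add: of_nat_diff)
    then have "(-1) ^ M * fact M = pochhammer (- real M) T * ((-1) ^ (M - T) * fact (M - T))"
      by (simp add: pochhammer_same)
    moreover have "(-1 :: real) ^ M = (-1) ^ T * (-1) ^ (M - T)"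
      using assms(1) by (simp flip: power_add)
    ultimately show ?thesis by (simp add: field_simps)
  qed
  moreover have "c ^ M = c ^ T * c ^ (M - T)"
    using assms(1) by (simp flip: power_add)
  moreover have "(- c) ^ T = (-1) ^ T * c ^ T"
    by (rule power_minus)
  ultimately show ?thesis
    using assms(2,3) by (cases "even T") (simp_all add: gbinomial_pochhammer')
qed

lemma LII_A_eq_rhs:
  assumes "(d, \<rho>, \<xi>) \<in> LII_admissible m" and "\<not> LII_exceptional m n i h0 (d, \<rho>, \<xi>)"
  shows "LII_A m n i (d, \<rho>, \<xi>) y = LII_rhs m n i h0 (d, \<rho>, \<xi>) y"
proof -
  define M where "M = n i - 1"
  define a where "a = d $ h0 + real (m h0)"
  define c where "c h = \<xi> $ i + \<rho> $ h" for h
  define chi where "chi = LII_chi m n i h0 (d, \<rho>, \<xi>)"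
  define B where "B h = binomial_fps (d $ h + real (m h)) (c h)" for h
  define C where "C k = binomial_fps (- real (n k)) (\<xi> $ i - \<xi> $ k)" for k
  define G where "G = fps_exp (- y) * ((\<Prod>h\<in>UNIV - {h0}. B h) * (\<Prod>k\<in>UNIV - {i}. C k))"
  \<comment> \<open>The power of \<open>- c h0\<close> collects the factors \<open>c h0\<close> from
    all summation indices and the signs that relate Pochhammer symbols to binomial coefficients and
    \<open>exp (- t y)\<close> to the powers of \<open>y\<close>. What remains is a product of
    coefficients of \<open>B\<close>, \<open>C\<close> and the exponential.\<close>
  define w where "w T = pochhammer (- real M) T / pochhammer chi T * (- c h0) ^ T" for T
  have "c h0 > 0"
    using assms(1) by (simp add: LII_admissible_def c_def)
  then have c0: "c h0 \<noteq> 0" by simp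
  have chi: "chi = a - real M + 1"
    by (simp add: chi_def LII_chi_def a_def M_def)
  have chi_nz: "pochhammer chi T \<noteq> 0" if "T \<le> M" for T
    using assms(2) that by (simp add: LII_exceptional_def chi_def M_def)
  have graded: "graded_sum (UNIV \<times> (UNIV - {h0} \<rightarrow>\<^sub>E UNIV) \<times> (UNIV - {i} \<rightarrow>\<^sub>E UNIV))
      (\<lambda>(l, r, s). l + ((\<Sum>h\<in>UNIV - {h0}. r h) + (\<Sum>k\<in>UNIV - {i}. s k)))
      (\<lambda>(l, r, s). fps_nth (fps_exp (- y)) l *
        ((\<Prod>h\<in>UNIV - {h0}. fps_nth (B h) (r h)) * (\<Prod>k\<in>UNIV - {i}. fps_nth (C k) (s k)))) G"
    using graded_sum_mult[OF graded_sum_id[of "fps_exp (- y)"]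
        graded_sum_mult[OF graded_sum_prod[of "UNIV - {h0}" B] graded_sum_prod[of "UNIV - {i}" C]]]
    by (simp add: G_def case_prod_unfold)
  have "LII_F m n i h0 (d, \<rho>, \<xi>) y = (\<Sum>T\<le>M. w T * fps_nth G T)"
  proof -
    have B_nth: "pochhammer (- (d $ h + real (m h))) j / fact j * (c h0 / c h) ^ j =
        (- c h0) ^ j * fps_nth (B h) j" for h j
      by (simp add: B_def binomial_fps_def gbinomial_pochhammer power_divide power_minus[of "c h0"])
    have C_nth: "pochhammer (real (n k)) j / fact j * (c h0 / (\<xi> $ i - \<xi> $ k)) ^ j =
        (- c h0) ^ j * fps_nth (C k) j" for k j
      by (simp add: C_def binomial_fps_def gbinomial_pochhammer power_divide power_minus[of "c h0"])
    have E_nth: "(c h0 * y) ^ l / fact l = (- c h0) ^ l * fps_nth (fps_exp (- y)) l" for l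
      by (simp add: power_mult_distrib power_minus[of "c h0"] power_minus[of y])
    have "LII_F m n i h0 (d, \<rho>, \<xi>) y =
      (\<Sum>\<^sub>\<infinity>x\<in>UNIV \<times> (UNIV - {h0} \<rightarrow>\<^sub>E UNIV) \<times> (UNIV - {i} \<rightarrow>\<^sub>E UNIV).
        w ((\<lambda>(l, r, s). l + ((\<Sum>h\<in>UNIV - {h0}. r h) + (\<Sum>k\<in>UNIV - {i}. s k))) x) *
        (\<lambda>(l, r, s). fps_nth (fps_exp (- y)) l *
          ((\<Prod>h\<in>UNIV - {h0}. fps_nth (B h) (r h)) * (\<Prod>k\<in>UNIV - {i}. fps_nth (C k) (s k)))) x)"
      unfolding LII_F_def prod.case Let_def c_def[symmetric] chi_def[symmetric] M_def[symmetric]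
        B_nth C_nth E_nth
      by (simp only: w_def prod.distrib power_add power_sum case_prod_unfold mult_ac add_ac
          times_divide_eq_left times_divide_eq_right)
    also have "\<dots> = (\<Sum>T\<le>M. w T * fps_nth G T)"
      \<comment> \<open>The cutoff is the vanishing of (-M)_T for \<open>T > M\<close>.\<close>
      by (rule infsum_graded_sum[OF graded]) (simp add: w_def pochhammer_of_nat_eq_0_lemma)
    finally show ?thesis .
  qed
  then have "pochhammer chi M / (fact M * c h0 ^ M) * LII_F m n i h0 (d, \<rho>, \<xi>) y =
      (\<Sum>T\<le>M. (pochhammer chi M / (fact M * c h0 ^ M) * w T) * fps_nth G T)"
    by (simp add: sum_distrib_left mult.assoc)
  also have "\<dots> = (\<Sum>T\<le>M. fps_nth G T * fps_nth (B h0) (M - T))"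
  proof (rule sum.cong[OF refl])
    fix T assume "T \<in> {..M}"
    then have "pochhammer chi M / (fact M * c h0 ^ M) * w T = (a gchoose (M - T)) / c h0 ^ (M - T)"
      using pochhammer_ratio_eq_gbinomial[of T M a "c h0"] chi_nz c0 by (simp add: w_def chi)
    then show "pochhammer chi M / (fact M * c h0 ^ M) * w T * fps_nth G T =
        fps_nth G T * fps_nth (B h0) (M - T)"
      by (simp add: B_def binomial_fps_def a_def)
  qed
  \<comment> \<open>The sum over \<open>T\<close> is a Cauchy product, which restores the factor
    belonging to \<open>h0\<close>.\<close>
  also have "\<dots> = fps_nth (G * B h0) M"
    by (simp add: fps_mult_nth atMost_atLeast0)
  also have "G * B h0 = LII_series m n i (d, \<rho>, \<xi>) * fps_exp (- y)"
  proof -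
    have "(\<Prod>h\<in>UNIV. B h) = B h0 * (\<Prod>h\<in>UNIV - {h0}. B h)"
      by (rule prod.remove) auto
    then show ?thesis
      by (simp add: G_def LII_series_def B_def C_def c_def mult_ac)
  qed
  finally show ?thesis
    using LII_A_eq_fps_nth[OF assms(1)]
    by (simp only: LII_rhs_def prod.case M_def c_def chi_def mult.assoc)
qed

section \<open>Polynomial continuation to exceptional parameters\<close>

text \<open>Sorting the Taylor coefficient by the powers of \<open>y\<close> in
  \<open>exp (- t y)\<close> yields explicit coefficients, whose limits can then be taken one by
  one.\<close>

definition LII_poly ::
  "('q::finite \<Rightarrow> nat) \<Rightarrow> ('p::finite \<Rightarrow> nat) \<Rightarrow> 'p \<Rightarrow> ('p, 'q) LII_param \<Rightarrow> real poly" where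
  "LII_poly m n i x = (\<Sum>l\<le>n i - 1. monom ((-1) ^ (\<Sum>k\<in>UNIV. n k) * LII_H m n i x *
     (fps_nth (LII_series m n i x) (n i - 1 - l) * ((-1) ^ l / fact l))) l)"

lemma poly_LII_poly:
  assumes "x \<in> LII_admissible m"
  shows "poly (LII_poly m n i x) y = LII_A m n i x y"
proof -
  have "fps_nth (fps_exp (- y) * LII_series m n i x) (n i - 1) =
      (\<Sum>l\<le>n i - 1. fps_nth (LII_series m n i x) (n i - 1 - l) * ((-1) ^ l / fact l) * y ^ l)"
    by (simp add: fps_mult_nth atMost_atLeast0 power_minus[of y] mult_ac)
  then show ?thesis
    using assms LII_A_eq_fps_nth[of "fst x" "fst (snd x)" "snd (snd x)" m n i y]
    by (simp add: LII_poly_def poly_sum poly_monom sum_distrib_left mult.assoc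
        mult.commute[of _ "fps_exp _"])
qed

text \<open>Each coefficient is a finite expression in the parameters; at an admissible point the
  bases of \<open>powr\<close> are positive and the denominators nonzero.\<close>

lemma tendsto_coeff_LII_poly:
  assumes "x \<in> LII_admissible m"
  shows "((\<lambda>t. coeff (LII_poly m n i t) j) \<longlongrightarrow> coeff (LII_poly m n i x) j) (at x within S)"
proof -
  obtain d \<rho> \<xi> where x: "x = (d, \<rho>, \<xi>)" by (cases x)
  have pos: "\<xi> $ i + \<rho> $ h > 0" and nz: "k \<noteq> i \<Longrightarrow> \<xi> $ i - \<xi> $ k \<noteq> 0" for h k
    using assms by (auto simp: LII_admissible_def x)
  have lim_d: "((\<lambda>t. fst t) \<longlongrightarrow> d) (at x within S)"
    and lim_\<rho>: "((\<lambda>t. fst (snd t)) \<longlongrightarrow> \<rho>) (at x within S)"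
    and lim_\<xi>: "((\<lambda>t. snd (snd t)) \<longlongrightarrow> \<xi>) (at x within S)"
    by (auto intro!: tendsto_eq_intros simp: x)
  note lims = tendsto_vec_nth[OF lim_d] tendsto_vec_nth[OF lim_\<rho>] tendsto_vec_nth[OF lim_\<xi>]
  have "((\<lambda>t. LII_H m n i t) \<longlongrightarrow> LII_H m n i x) (at x within S)"
    unfolding LII_H_def case_prod_unfold x fst_conv snd_conv
    by (intro tendsto_intros lims[unfolded x]) (use pos nz in \<open>auto simp: less_imp_neq[symmetric]\<close>)
  moreover have "((\<lambda>t. fps_nth (LII_series m n i t) N) \<longlongrightarrow> fps_nth (LII_series m n i x) N)
      (at x within S)" for N
    unfolding LII_series_def case_prod_unfold x fst_conv snd_conv
    by (intro tendsto_fps_nth_mult tendsto_fps_nth_prod tendsto_binomial_fps tendsto_intros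
        lims[unfolded x]) (use pos nz in \<open>auto simp: less_imp_neq[symmetric]\<close>)
  ultimately show ?thesis
    unfolding LII_poly_def coeff_sum coeff_monom
    by (intro tendsto_sum) (auto intro!: tendsto_intros)
qed

text \<open>Exceptional means that \<chi> is one of finitely many nonpositive integers. Increasing
  \<open>d $ h0\<close> by less than 1 makes \<chi> non-integral and preserves
  admissibility.\<close>

lemma islimpt_non_exceptional:
  assumes adm: "(d, \<rho>, \<xi>) \<in> LII_admissible m" and exc: "LII_exceptional m n i h0 (d, \<rho>, \<xi>)"
  shows "(d, \<rho>, \<xi>) islimpt {t \<in> LII_admissible m. \<not> LII_exceptional m n i h0 t}"
  unfolding islimpt_approachable
proof (intro allI impI)
  fix e :: real assume "e > 0"
  define \<epsilon> where "\<epsilon> = min (e / 2) (1 / 2)"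
  have \<epsilon>: "\<epsilon> > 0" "\<epsilon> < e" "\<epsilon> < 1"
    using \<open>e > 0\<close> by (auto simp: \<epsilon>_def)
  define d' where "d' = d + \<epsilon> *\<^sub>R axis h0 1"
  have d'_nth: "d' $ h = d $ h + (if h = h0 then \<epsilon> else 0)" for h
    by (simp add: d'_def axis_def)
  obtain j :: nat where j: "LII_chi m n i h0 (d, \<rho>, \<xi>) = - real j"
    using exc by (auto simp: LII_exceptional_def pochhammer_eq_0_iff)
  then have chi: "LII_chi m n i h0 (d', \<rho>, \<xi>) = \<epsilon> - real j"
    by (simp add: LII_chi_def d'_nth)
  \<comment> \<open>Equality would make \<epsilon> an integer strictly between 0 and 1.\<close>
  have "\<epsilon> - real j \<noteq> - real k" for k
  proof
    assume "\<epsilon> - real j = - real k"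
    then have "\<epsilon> = real_of_int (int j - int k)" by simp
    then have "0 < int j - int k" "int j - int k < 1" using \<epsilon> by linarith+
    then show False by linarith
  qed
  then have "\<not> LII_exceptional m n i h0 (d', \<rho>, \<xi>)"
    by (simp add: LII_exceptional_def chi pochhammer_eq_0_iff)
  moreover have "(d', \<rho>, \<xi>) \<in> LII_admissible m"
    using adm \<epsilon>(1) by (auto simp: LII_admissible_def d'_nth add_pos_pos)
  moreover have "(d', \<rho>, \<xi>) \<noteq> (d, \<rho>, \<xi>)"
    using \<epsilon>(1) d'_nth[of h0] by auto
  moreover have "dist (d', \<rho>, \<xi>) (d, \<rho>, \<xi>) < e"
    using \<epsilon> by (simp add: dist_Pair_Pair d'_def dist_norm norm_axis_1)
  ultimately show "\<exists>x'\<in>{t \<in> LII_admissible m. \<not> LII_exceptional m n i h0 t}.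
      x' \<noteq> (d, \<rho>, \<xi>) \<and> dist x' (d, \<rho>, \<xi>) < e"
    by blast
qed

text \<open>A real polynomial is determined by its values, so both families \<open>Q\<close> agree
  on \<open>S\<close>; limits are unique because \<open>x\<close> is a limit point of
  \<open>S\<close>.\<close>

lemma poly_continuation_unique:
  assumes "poly_continuation f S x P" and "poly_continuation f S x P'"
  shows "P = P'"
proof (rule poly_eqI)
  fix j
  obtain Q where Q: "\<And>t y. t \<in> S \<Longrightarrow> f t y = poly (Q t) y"
    "((\<lambda>t. coeff (Q t) j) \<longlongrightarrow> coeff P j) (at x within S)"
    using assms(1) unfolding poly_continuation_def by blast
  obtain Q' where Q': "\<And>t y. t \<in> S \<Longrightarrow> f t y = poly (Q' t) y"
    "((\<lambda>t. coeff (Q' t) j) \<longlongrightarrow> coeff P' j) (at x within S)"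
    using assms(2) unfolding poly_continuation_def by blast
  have "Q t = Q' t" if "t \<in> S" for t
    using Q(1)[OF that] Q'(1)[OF that] by (simp add: poly_eq_poly_eq_iff[symmetric] fun_eq_iff)
  then have "\<forall>\<^sub>F t in at x within S. coeff (Q' t) j = coeff (Q t) j"
    by (auto simp: eventually_at_filter)
  from this Q'(2) have "((\<lambda>t. coeff (Q t) j) \<longlongrightarrow> coeff P' j) (at x within S)"
    by (rule tendsto_cong[THEN iffD1])
  moreover have "at x within S \<noteq> bot"
    using assms(1) by (simp add: poly_continuation_def trivial_limit_within)
  ultimately show "coeff P j = coeff P' j"
    using tendsto_unique[OF _ Q(2)] by simp
qed

text \<open>The polynomials of \<open>LII_A\<close> serve as the family \<open>Q\<close>: they
  represent \<open>LII_rhs\<close> at non-exceptional parameters and are continuous at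
  \<open>x\<close>.\<close>

lemma LII_continuation_LII_poly:
  assumes "x \<in> LII_admissible m" and "LII_exceptional m n i h0 x"
  shows "LII_continuation m n i h0 x (LII_poly m n i x)"
  unfolding LII_continuation_def poly_continuation_def
proof (intro conjI exI ballI allI)
  show "x islimpt {t \<in> LII_admissible m. \<not> LII_exceptional m n i h0 t}"
    using islimpt_non_exceptional assms by (cases x) blast
next
  fix t y assume "t \<in> {t \<in> LII_admissible m. \<not> LII_exceptional m n i h0 t}"
  then show "LII_rhs m n i h0 t y = poly (LII_poly m n i t) y"
    by (cases t) (simp add: poly_LII_poly LII_A_eq_rhs[symmetric])
qed (rule tendsto_coeff_LII_poly[OF assms(1)])

lemma ex1_LII_continuation:
  assumes "x \<in> LII_admissible m" and "LII_exceptional m n i h0 x"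
  shows "\<exists>!P. LII_continuation m n i h0 x P"
  using LII_continuation_LII_poly[OF assms] poly_continuation_unique
  unfolding LII_continuation_def by blast

lemma LII_value_eq_A:
  assumes "x \<in> LII_admissible m"
  shows "LII_value m n i h0 x y = LII_A m n i x y"
proof (cases "LII_exceptional m n i h0 x")
  case True
  then have "(THE P. LII_continuation m n i h0 x P) = LII_poly m n i x"
    using ex1_LII_continuation LII_continuation_LII_poly assms by (intro the1_equality) blast+
  with True assms show ?thesis
    by (simp add: LII_value_def poly_LII_poly)
next
  case False
  with assms show ?thesis
    by (cases x) (simp add: LII_value_def LII_A_eq_rhs[symmetric])
qed

theorem corollary4p4:
  fixes d \<rho> :: "real ^ 'q::finite" and \<xi> :: "real ^ 'p::finite"
    and m :: "'q \<Rightarrow> nat" and n :: "'p \<Rightarrow> nat"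
  assumes "(d, \<rho>, \<xi>) \<in> LII_admissible m"
    and "near_diagonal m"
    and "(\<Sum>k\<in>UNIV. n k) = (\<Sum>h\<in>UNIV. m h) + 1"
  shows "\<forall>i. n i \<ge> 1 \<longrightarrow>
    (\<forall>h0.
      (\<not> LII_exceptional m n i h0 (d, \<rho>, \<xi>) \<longrightarrow>
        (\<forall>y. LII_A m n i (d, \<rho>, \<xi>) y =
          (-1) ^ (\<Sum>k\<in>UNIV. n k) * LII_H m n i (d, \<rho>, \<xi>) *
          (pochhammer (LII_chi m n i h0 (d, \<rho>, \<xi>)) (n i - 1) /
            (fact (n i - 1) * (\<xi> $ i + \<rho> $ h0) ^ (n i - 1))) *
          LII_F m n i h0 (d, \<rho>, \<xi>) y)) \<and>
      (LII_exceptional m n i h0 (d, \<rho>, \<xi>) \<longrightarrow>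
        (\<exists>!P. LII_continuation m n i h0 (d, \<rho>, \<xi>) P)) \<and>
      (\<forall>y. LII_A m n i (d, \<rho>, \<xi>) y = LII_value m n i h0 (d, \<rho>, \<xi>) y)) \<and>
    (\<forall>h0 h0' y. LII_value m n i h0 (d, \<rho>, \<xi>) y = LII_value m n i h0' (d, \<rho>, \<xi>) y)"
  \<comment> \<open>Independence of \<open>h0\<close> follows since every \<open>LII_value\<close>
    equals \<open>LII_A\<close>, in which \<open>h0\<close> does not occur.\<close>
  using LII_A_eq_rhs[OF assms(1), of n] ex1_LII_continuation[OF assms(1), of n]
  by (simp add: LII_value_eq_A[OF assms(1)] LII_rhs_def del: One_nat_def)

end
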